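(* (Skew semi-continuous limit of the lattice modified Boussinesq equation A2.) Let $g_3(s)=s^3+\alpha_2s^2+\alpha_1s+\alpha_0$ with real coefficients, let $p,a\in\mathbb R$ with $p\neq a$, and let $v_{-2},v_{-1},v_0,v_1,v_2:\mathbb R\to\mathbb R$ be smooth and nowhere zero. Fix $\tau\in\mathbb R$ with $(p-a)\dot v_0(\tau)-v_0(\tau)\neq0$. For $\delta\ne0$ small put $q=p-\delta$, $P=g_3(p)-g_3(a)$, $Q=g_3(q)-g_3(a)$, and for $\nu,\mu\in\{-1,0,1\}$ set $$x_{\nu,\mu}=(p-a)^{-\nu}(q-a)^{-\mu}\,v_{\nu+\mu}\big(\tau+\tfrac12(\nu-\mu)\delta\big).$$ Let $$E=\left(\frac{P x_{0,0}-Qx_{-1,1}}{x_{-1,1}-x_{0,0}}\right)\frac{x_{0,1}}{x_{-1,0}}-\left(\frac{Px_{1,-1}-Qx_{0,0}}{x_{0,0}-x_{1,-1}}\right)\frac{x_{1,0}}{x_{0,-1}}-\left(\frac{x_{-1,-1}}{x_{0,-1}}-\frac{x_{-1,-1}}{x_{-1,0}}-\frac{x_{0,1}}{x_{1,1}}+\frac{x_{1,0}}{x_{1,1}}\right).$$ Then, as $\delta\to0$, $-E/\delta$ converges to $$\partial_\tau\left(\frac{v_1}{v_{-1}}\,\frac{\Pi_1\dot v_0+\Pi_2v_0}{(p-a)\dot v_0-v_0}\right)-\frac{v_{-2}}{v_{-1}}\left((p-a)\frac{\dot v_{-1}}{v_{-1}}-1\right)+\frac{v_1}{v_2}\left((p-a)\frac{\dot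 v_1}{v_1}-1\right),$$ evaluated at $\tau$, where $\Pi_1=\dfrac{g_3(p)-g_3(a)}{a-p}$ and $\Pi_2=-(a+2p+\alpha_2)$.
   Context: Dots denote derivatives with respect to $\tau$. $E=0$ is the one-component equation (in the variable $x$) of the A2 lattice system, on a $3\times3$ stencil centred at the origin; the vanishing of the limit is its skew semi-continuous limit. *)

theory Defs
  imports "HOL-Analysis.Analysis"
begin

(* C-infinity: all iterated derivatives exist everywhere. *)
definition smooth :: "(real \<Rightarrow> real) \<Rightarrow> bool" where
  "smooth f \<longleftrightarrow> (\<forall>n t. (deriv ^^ n) f differentiable (at t))"

definition g3 :: "real \<Rightarrow> real \<Rightarrow> real \<Rightarrow> real \<Rightarrow> real" where
  "g3 \<alpha>0 \<alpha>1 \<alpha>2 s = s ^ 3 + \<alpha>2 * s ^ 2 + \<alpha>1 * s + \<alpha>0"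

(* Left-hand side of the one-component A2 equation on the 3 x 3 stencil centred at the origin. *)
definition A2_eq :: "real \<Rightarrow> real \<Rightarrow> (int \<Rightarrow> int \<Rightarrow> real) \<Rightarrow> real" where
  "A2_eq P Q x =
     ((P * x 0 0 - Q * x (-1) 1) / (x (-1) 1 - x 0 0)) * (x 0 1 / x (-1) 0)
   - ((P * x 1 (-1) - Q * x 0 0) / (x 0 0 - x 1 (-1))) * (x 1 0 / x 0 (-1))
   - (x (-1) (-1) / x 0 (-1) - x (-1) (-1) / x (-1) 0 - x 0 1 / x 1 1 + x 1 0 / x 1 1)"

(* v is indexed by all integers, but only v (-2), ..., v 2 enter for \<nu>, \<mu> in {-1, 0, 1}. *)
definition skew_x ::
  "real \<Rightarrow> real \<Rightarrow> (int \<Rightarrow> real \<Rightarrow> real) \<Rightarrow> real \<Rightarrow> real \<Rightarrow> int \<Rightarrow> int \<Rightarrow> real" where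
  "skew_x p a v \<tau> \<delta> \<nu> \<mu> =
     (p - a) powi (- \<nu>) * ((p - \<delta>) - a) powi (- \<mu>)
       * v (\<nu> + \<mu>) (\<tau> + (1 / 2) * of_int (\<nu> - \<mu>) * \<delta>)"

end

theory Submission
  imports Defs
begin

text \<open>
  Write \<open>h = p - a\<close>, \<open>k = h - \<delta>\<close>, \<open>A = P / h\<close> and \<open>B = Q / k\<close>. The first two summands of the
  lattice equation are the values at \<open>\<tau> - \<delta>/2\<close> and \<open>\<tau> + \<delta>/2\<close> of
  \<open>s \<mapsto> (v\<^sub>1 / v\<^sub>-\<^sub>1)(s) N / M\<close> with \<open>N = A v\<^sub>0(s + \<delta>/2) - B v\<^sub>0(s - \<delta>/2)\<close> and
  \<open>M = h v\<^sub>0(s - \<delta>/2) - k v\<^sub>0(s + \<delta>/2)\<close>. Since \<open>A - B\<close> is divisible by \<open>\<delta>\<close>, both \<open>N / \<delta>\<close> and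
  \<open>M / \<delta>\<close> converge; the difference of the two summands over \<open>\<delta>\<close> is then a central difference,
  whose limit only needs first and second difference quotients of \<open>v\<^sub>0\<close> and \<open>v\<^sub>1 / v\<^sub>-\<^sub>1\<close>.
\<close>

section \<open>Limits of first and second difference quotients\<close>

lemma smooth_DERIV:
  assumes "smooth f"
  shows "(f has_real_derivative deriv f t) (at t)"
    and "(deriv f has_real_derivative deriv (deriv f) t) (at t)"
proof -
  have "(deriv ^^ 0) f differentiable (at t)" "(deriv ^^ 1) f differentiable (at t)"
    using assms unfolding smooth_def by blast+
  then show "(f has_real_derivative deriv f t) (at t)"
    and "(deriv f has_real_derivative deriv (deriv f) t) (at t)"
    by (simp_all add: DERIV_deriv_iff_real_differentiable)
qed

text \<open>The factor \<open>c\<close> covers full and half steps in both directions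
  (\<open>c\<close> = 1, -1, 1/2, -1/2) at once.\<close>

lemma DERIV_imp_diff_quotient_scaled:
  fixes f :: "real \<Rightarrow> real"
  assumes "(f has_real_derivative D) (at t)"
  shows "((\<lambda>\<delta>. (f (t + c * \<delta>) - f t) / \<delta>) \<longlongrightarrow> c * D) (at 0)"
proof -
  have "(f has_real_derivative D) (at (t + c * 0))"
    using assms by simp
  then have "((\<lambda>\<delta>. f (t + c * \<delta>)) has_real_derivative D * c) (at 0)"
    by (rule DERIV_chain2) (auto intro!: derivative_eq_intros)
  then show ?thesis
    by (simp add: DERIV_def mult.commute)
qed

lemma DERIV_imp_tendsto_scaled:
  fixes f :: "real \<Rightarrow> real"
  assumes "(f has_real_derivative D) (at t)"
  shows "((\<lambda>\<delta>. f (t + c * \<delta>)) \<longlongrightarrow> f t) (at 0)"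
proof -
  have "isCont (\<lambda>\<delta>. t + c * \<delta>) 0" "isCont f (t + c * 0)"
    using DERIV_isCont[OF assms] by simp_all
  then have "isCont (\<lambda>\<delta>. f (t + c * \<delta>)) 0"
    by (rule isCont_o2)
  then show ?thesis
    by (simp add: isCont_def)
qed

lemma DERIV_imp_central_diff_quotient:
  fixes f :: "real \<Rightarrow> real"
  assumes "(f has_real_derivative D) (at t)"
  shows "((\<lambda>\<delta>. (f (t + c * \<delta>) - f (t - c * \<delta>)) / \<delta>) \<longlongrightarrow> 2 * c * D) (at 0)"
proof -
  have "((\<lambda>\<delta>. (f (t + c * \<delta>) - f t) / \<delta> - (f (t + (- c) * \<delta>) - f t) / \<delta>)
          \<longlongrightarrow> c * D - (- c) * D) (at 0)"
    by (intro tendsto_diff DERIV_imp_diff_quotient_scaled assms)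
  then show ?thesis
    by (simp add: diff_divide_distrib mult.commute mult.assoc)
qed

text \<open>One application of l'Hopital's rule leaves the central difference quotient of
  \<open>f'\<close>, which converges as soon as \<open>f'\<close> is differentiable at the single
  point \<open>t\<close>; a second application would ask for continuity of the second
  derivative.\<close>

lemma second_central_diff_quotient:
  fixes f f' :: "real \<Rightarrow> real"
  assumes f: "\<And>s. (f has_real_derivative f' s) (at s)"
    and f': "(f' has_real_derivative f'') (at t)"
  shows "((\<lambda>\<delta>. (f (t + \<delta>) - 2 * f t + f (t - \<delta>)) / \<delta>\<^sup>2) \<longlongrightarrow> f'') (at 0)"
proof (rule lhopital)
  have D: "((\<lambda>\<delta>. f (t + \<delta>) - 2 * f t + f (t - \<delta>)) has_real_derivative f' (t + \<delta>) - f' (t - \<delta>))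
      (at \<delta>)" for \<delta>
    by (auto intro!: derivative_eq_intros DERIV_chain2[OF f])
  then show "\<forall>\<^sub>F \<delta> in at 0. ((\<lambda>\<delta>. f (t + \<delta>) - 2 * f t + f (t - \<delta>))
      has_real_derivative f' (t + \<delta>) - f' (t - \<delta>)) (at \<delta>)"
    by simp
  show "((\<lambda>\<delta>. f (t + \<delta>) - 2 * f t + f (t - \<delta>)) \<longlongrightarrow> 0) (at 0)"
    using DERIV_isCont[OF D[of 0]] by (simp add: isCont_def)
  show "((\<lambda>\<delta>::real. \<delta>\<^sup>2) \<longlongrightarrow> 0) (at 0)"
    by (auto intro!: tendsto_eq_intros)
  show "\<forall>\<^sub>F \<delta>::real in at 0. \<delta>\<^sup>2 \<noteq> 0" "\<forall>\<^sub>F \<delta>::real in at 0. 2 * \<delta> \<noteq> 0"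
    by (auto simp: eventually_at_filter)
  show "\<forall>\<^sub>F \<delta>::real in at 0. ((\<lambda>\<delta>. \<delta>\<^sup>2) has_real_derivative 2 * \<delta>) (at \<delta>)"
    by (auto intro!: derivative_eq_intros always_eventually)
  have "((\<lambda>\<delta>. (f' (t + 1 * \<delta>) - f' (t - 1 * \<delta>)) / \<delta> / 2) \<longlongrightarrow> 2 * 1 * f'' / 2) (at 0)"
    by (intro tendsto_divide DERIV_imp_central_diff_quotient f' tendsto_const) simp
  then show "((\<lambda>\<delta>. (f' (t + \<delta>) - f' (t - \<delta>)) / (2 * \<delta>)) \<longlongrightarrow> f'') (at 0)"
    by (simp add: mult.commute)
qed

section \<open>Algebraic form of the lattice equation on the skew stencil\<close>

lemma g3_diff_factor:
  "g3 \<alpha>0 \<alpha>1 \<alpha>2 s - g3 \<alpha>0 \<alpha>1 \<alpha>2 a = (s - a) * (s\<^sup>2 + s * a + a\<^sup>2 + \<alpha>2 * (s + a) + \<alpha>1)"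
  unfolding g3_def by algebra

text \<open>With P = \<open>h * A\<close> and Q = \<open>k * B\<close> the powers of
  \<open>h\<close> and \<open>k\<close> in \<open>skew_x\<close> cancel against each other. Nothing
  else is cancelled, so \<open>h\<close> and \<open>k\<close> are the only quantities that must be
  nonzero: where another denominator is 0, both sides follow the convention x / 0 = 0.\<close>

lemma A2_eq_skew_x:
  fixes p a \<tau> \<delta> A B :: real and v :: "int \<Rightarrow> real \<Rightarrow> real"
  defines "h \<equiv> p - a" and "k \<equiv> p - \<delta> - a"
  assumes h: "h \<noteq> 0" and k: "k \<noteq> 0"
  shows "A2_eq (h * A) (k * B) (skew_x p a v \<tau> \<delta>) =
      (A * v 0 \<tau> - B * v 0 (\<tau> - \<delta>)) / (h * v 0 (\<tau> - \<delta>) - k * v 0 \<tau>)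
        * (v 1 (\<tau> - \<delta> / 2) / v (-1) (\<tau> - \<delta> / 2))
    - (A * v 0 (\<tau> + \<delta>) - B * v 0 \<tau>) / (h * v 0 \<tau> - k * v 0 (\<tau> + \<delta>))
        * (v 1 (\<tau> + \<delta> / 2) / v (-1) (\<tau> + \<delta> / 2))
    - (v (-2) \<tau> * (h / v (-1) (\<tau> + \<delta> / 2) - k / v (-1) (\<tau> - \<delta> / 2))
       + (k * v 1 (\<tau> + \<delta> / 2) - h * v 1 (\<tau> - \<delta> / 2)) / v 2 \<tau>)"
proof -
  \<comment> \<open>\<open>1\<close>, \<open>2\<close> and \<open>3\<close> treat the three summands
    of \<open>A2_eq\<close>. Their left-hand sides have the literal shape that rewriting with the
    stencil values \<open>x\<close> produces.\<close>
  have 1: "(h * A * x - k * B * (h * inverse k * y)) / (h * inverse k * y - x)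
             * ((inverse k * b) / (h * c))
           = (A * x - B * y) / (h * y - k * x) * (b / c)" for x y b c :: real
  proof -
    have "h * A * x - k * B * (h * inverse k * y) = h * (A * x - B * y)"
      and "h * inverse k * y - x = (h * y - k * x) / k"
      using k by (simp_all add: field_simps)
    then show ?thesis
      using h k by simp
  qed
  have 2: "(h * A * (inverse h * k * y) - k * B * x) / (x - inverse h * k * y)
             * ((inverse h * b) / (k * c))
           = (A * y - B * x) / (h * x - k * y) * (b / c)" for x y b c :: real
  proof -
    have "h * A * (inverse h * k * y) - k * B * x = k * (A * y - B * x)"
      and "x - inverse h * k * y = (h * x - k * y) / h"
      using h by (simp_all add: field_simps)
    then show ?thesis
      using h k by simp
  qed
  have 3: "h * k * z / (k * c) - h * k * z / (h * b)
        - inverse k * x / (inverse h * inverse k * d) + inverse h * y / (inverse h * inverse k * d)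
      = z * (h / c - k / b) + (k * y - h * x) / d" for b c d x y z :: real
  proof -
    have "h * k * z / (k * c) = z * (h / c)" "h * k * z / (h * b) = z * (k / b)"
      using h k by simp_all
    moreover have "inverse k * x / (inverse h * inverse k * d) = h * x / d"
      "inverse h * y / (inverse h * inverse k * d) = k * y / d"
      using h k by (simp_all add: divide_inverse)
    ultimately show ?thesis
      by (simp add: right_diff_distrib diff_divide_distrib)
  qed
  have x: "skew_x p a v \<tau> \<delta> 0 0 = v 0 \<tau>"
    "skew_x p a v \<tau> \<delta> (-1) 1 = h * inverse k * v 0 (\<tau> - \<delta>)"
    "skew_x p a v \<tau> \<delta> 1 (-1) = inverse h * k * v 0 (\<tau> + \<delta>)"
    "skew_x p a v \<tau> \<delta> 0 1 = inverse k * v 1 (\<tau> - \<delta> / 2)"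
    "skew_x p a v \<tau> \<delta> (-1) 0 = h * v (-1) (\<tau> - \<delta> / 2)"
    "skew_x p a v \<tau> \<delta> 1 0 = inverse h * v 1 (\<tau> + \<delta> / 2)"
    "skew_x p a v \<tau> \<delta> 0 (-1) = k * v (-1) (\<tau> + \<delta> / 2)"
    "skew_x p a v \<tau> \<delta> (-1) (-1) = h * k * v (-2) \<tau>"
    "skew_x p a v \<tau> \<delta> 1 1 = inverse h * inverse k * v 2 \<tau>"
    unfolding skew_x_def h_def k_def by (simp_all add: power_int_minus)
  show ?thesis
    unfolding A2_eq_def x 1 2 3 ..
qed

section \<open>Limit of the two fractional summands\<close>

text \<open>Discrete product and quotient rule: over the common denominator, the numerator
  telescopes by changing one of the three factors at a time.\<close>

lemma central_difference_quotient_identity: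
  fixes \<delta> n\<^sub>1 n\<^sub>2 m\<^sub>1 m\<^sub>2 w\<^sub>1 w\<^sub>2 :: real
  assumes "\<delta> \<noteq> 0" "m\<^sub>1 \<noteq> 0" "m\<^sub>2 \<noteq> 0"
  shows "(n\<^sub>2 / m\<^sub>2 * w\<^sub>2 - n\<^sub>1 / m\<^sub>1 * w\<^sub>1) / \<delta> =
    ((n\<^sub>2 - n\<^sub>1) / \<delta> * w\<^sub>2 * m\<^sub>1 + n\<^sub>1 * ((w\<^sub>2 - w\<^sub>1) / \<delta>) * m\<^sub>1 - n\<^sub>1 * w\<^sub>1 * ((m\<^sub>2 - m\<^sub>1) / \<delta>))
      / (m\<^sub>1 * m\<^sub>2)"
  using assms by (simp add: field_simps)

text \<open>The limit is the derivative at \<open>t\<close> of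
  \<open>w * (A * u' + \<beta> * u) / (u - h * u')\<close>, spelled out by the quotient rule. The
  coefficient \<open>A - \<delta> * (\<beta> - \<delta>)\<close> is the value of B for the
  cubic.\<close>

lemma skew_limit_quotient_part:
  fixes u w :: "real \<Rightarrow> real" and A \<beta> h t :: real
  assumes u: "\<And>s. (u has_real_derivative u' s) (at s)"
    and u': "(u' has_real_derivative u'') (at t)"
    and w: "(w has_real_derivative w') (at t)"
    and M: "u t - h * u' t \<noteq> 0"
  shows "((\<lambda>\<delta>.
      ((A * u (t + \<delta>) - (A - \<delta> * (\<beta> - \<delta>)) * u t) / (h * u t - (h - \<delta>) * u (t + \<delta>)) * w (t + \<delta> / 2)
     - (A * u t - (A - \<delta> * (\<beta> - \<delta>)) * u (t - \<delta>)) / (h * u (t - \<delta>) - (h - \<delta>) * u t) * w (t - \<delta> / 2))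
      / \<delta>)
    \<longlongrightarrow> ((A * u'' + \<beta> * u' t) * w t * (u t - h * u' t)
       + (A * u' t + \<beta> * u t) * w' * (u t - h * u' t)
       - (A * u' t + \<beta> * u t) * w t * (u' t - h * u'')) / ((u t - h * u' t) * (u t - h * u' t)))
    (at 0)"
proof -
  define d\<^sub>2 d\<^sub>1 where "d\<^sub>2 = (\<lambda>\<delta>. (u (t + \<delta>) - u t) / \<delta>)" and "d\<^sub>1 = (\<lambda>\<delta>. (u t - u (t - \<delta>)) / \<delta>)"
  define s where "s = (\<lambda>\<delta>. (u (t + \<delta>) - 2 * u t + u (t - \<delta>)) / \<delta>\<^sup>2)"
  \<comment> \<open>Numerators and denominators with their common factor \<delta> removed; index 2
    belongs to the midpoint t + \<delta>/2, index 1 to t - \<delta>/2.\<close>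
  define n\<^sub>2 n\<^sub>1 m\<^sub>2 m\<^sub>1
    where "n\<^sub>2 = (\<lambda>\<delta>. A * d\<^sub>2 \<delta> + (\<beta> - \<delta>) * u t)"
      and "n\<^sub>1 = (\<lambda>\<delta>. A * d\<^sub>1 \<delta> + (\<beta> - \<delta>) * u (t - \<delta>))"
      and "m\<^sub>2 = (\<lambda>\<delta>. u (t + \<delta>) - h * d\<^sub>2 \<delta>)"
      and "m\<^sub>1 = (\<lambda>\<delta>. u t - h * d\<^sub>1 \<delta>)"
  have up: "((\<lambda>\<delta>. u (t + \<delta>)) \<longlongrightarrow> u t) (at 0)"
    using DERIV_imp_tendsto_scaled[OF u, of t 1] by simp
  have um: "((\<lambda>\<delta>. u (t - \<delta>)) \<longlongrightarrow> u t) (at 0)"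
    using DERIV_imp_tendsto_scaled[OF u, of t "-1"] by simp
  have wp: "((\<lambda>\<delta>. w (t + \<delta> / 2)) \<longlongrightarrow> w t) (at 0)"
    using DERIV_imp_tendsto_scaled[OF w, of "1/2"] by simp
  have wm: "((\<lambda>\<delta>. w (t - \<delta> / 2)) \<longlongrightarrow> w t) (at 0)"
    using DERIV_imp_tendsto_scaled[OF w, of "-1/2"] by simp
  have dw: "((\<lambda>\<delta>. (w (t + \<delta> / 2) - w (t - \<delta> / 2)) / \<delta>) \<longlongrightarrow> w') (at 0)"
    using DERIV_imp_central_diff_quotient[OF w, of "1/2"] by simp
  have d2: "(d\<^sub>2 \<longlongrightarrow> u' t) (at 0)"
    using DERIV_imp_diff_quotient_scaled[OF u, of t 1] by (simp add: d\<^sub>2_def)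
  have d1: "(d\<^sub>1 \<longlongrightarrow> u' t) (at 0)"
    using tendsto_minus[OF DERIV_imp_diff_quotient_scaled[OF u, of t "-1"]]
    by (simp add: d\<^sub>1_def minus_divide_left)
  have s: "(s \<longlongrightarrow> u'') (at 0)"
    unfolding s_def by (rule second_central_diff_quotient[OF u u'])
  have \<beta>: "((\<lambda>\<delta>. \<beta> - \<delta>) \<longlongrightarrow> \<beta>) (at 0)"
    by (auto intro!: tendsto_eq_intros)
  have n1: "(n\<^sub>1 \<longlongrightarrow> A * u' t + \<beta> * u t) (at 0)"
    unfolding n\<^sub>1_def by (intro tendsto_intros d1 um \<beta>)
  have m2: "(m\<^sub>2 \<longlongrightarrow> u t - h * u' t) (at 0)"
    unfolding m\<^sub>2_def by (intro tendsto_intros d2 up)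
  have m1: "(m\<^sub>1 \<longlongrightarrow> u t - h * u' t) (at 0)"
    unfolding m\<^sub>1_def by (intro tendsto_intros d1)
  \<comment> \<open>\<open>dn\<close> and \<open>dm\<close> concern the difference quotients of the
    n's and of the m's. The former contains \<open>d\<^sub>1\<close> because the n's carry u at t
    and t - \<delta>, the latter \<open>d\<^sub>2\<close> because the m's carry u at t + \<delta>
    and t.\<close>
  have dn: "((\<lambda>\<delta>. A * s \<delta> + (\<beta> - \<delta>) * d\<^sub>1 \<delta>) \<longlongrightarrow> A * u'' + \<beta> * u' t) (at 0)"
    by (intro tendsto_intros s d1 \<beta>)
  have dm: "((\<lambda>\<delta>. d\<^sub>2 \<delta> - h * s \<delta>) \<longlongrightarrow> u' t - h * u'') (at 0)"
    by (intro tendsto_intros s d2)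
  have lim: "((\<lambda>\<delta>. ((A * s \<delta> + (\<beta> - \<delta>) * d\<^sub>1 \<delta>) * w (t + \<delta> / 2) * m\<^sub>1 \<delta>
        + n\<^sub>1 \<delta> * ((w (t + \<delta> / 2) - w (t - \<delta> / 2)) / \<delta>) * m\<^sub>1 \<delta>
        - n\<^sub>1 \<delta> * w (t - \<delta> / 2) * (d\<^sub>2 \<delta> - h * s \<delta>)) / (m\<^sub>1 \<delta> * m\<^sub>2 \<delta>))
    \<longlongrightarrow> ((A * u'' + \<beta> * u' t) * w t * (u t - h * u' t)
       + (A * u' t + \<beta> * u t) * w' * (u t - h * u' t)
       - (A * u' t + \<beta> * u t) * w t * (u' t - h * u'')) / ((u t - h * u' t) * (u t - h * u' t)))
    (at 0)"
    \<comment> \<open>The patterns restrict splitting to the outer sum and difference, so that the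
      inner ones are matched whole by \<open>dn\<close>, \<open>dm\<close>, \<open>n1\<close>,
      \<open>m1\<close> and \<open>m2\<close>.\<close>
    by (intro tendsto_divide tendsto_diff[of _ "_ + _"] tendsto_add[of _ "_ * _ * (_ - _)"]
        tendsto_mult dn dm dw n1 m1 m2 wp wm) (use M in simp)
  have "\<forall>\<^sub>F \<delta> in at 0. m\<^sub>1 \<delta> \<noteq> 0" "\<forall>\<^sub>F \<delta> in at 0. m\<^sub>2 \<delta> \<noteq> 0" "\<forall>\<^sub>F \<delta>::real in at 0. \<delta> \<noteq> 0"
    using tendsto_imp_eventually_ne[OF m1 M] tendsto_imp_eventually_ne[OF m2 M]
    by (auto simp: eventually_at_filter)
  then have "\<forall>\<^sub>F \<delta> in at 0.
      ((A * s \<delta> + (\<beta> - \<delta>) * d\<^sub>1 \<delta>) * w (t + \<delta> / 2) * m\<^sub>1 \<delta>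
        + n\<^sub>1 \<delta> * ((w (t + \<delta> / 2) - w (t - \<delta> / 2)) / \<delta>) * m\<^sub>1 \<delta>
        - n\<^sub>1 \<delta> * w (t - \<delta> / 2) * (d\<^sub>2 \<delta> - h * s \<delta>)) / (m\<^sub>1 \<delta> * m\<^sub>2 \<delta>) =
      ((A * u (t + \<delta>) - (A - \<delta> * (\<beta> - \<delta>)) * u t) / (h * u t - (h - \<delta>) * u (t + \<delta>)) * w (t + \<delta> / 2)
     - (A * u t - (A - \<delta> * (\<beta> - \<delta>)) * u (t - \<delta>)) / (h * u (t - \<delta>) - (h - \<delta>) * u t) * w (t - \<delta> / 2))
      / \<delta>"
  proof eventually_elim
    case (elim \<delta>)
    \<comment> \<open>Once the shifted values of u are written through \<open>d\<^sub>1\<close> and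
      \<open>d\<^sub>2\<close>, the factor \<delta> can be split off by polynomial
      identities.\<close>
    have ud: "u (t + \<delta>) = u t + \<delta> * d\<^sub>2 \<delta>" "u (t - \<delta>) = u t - \<delta> * d\<^sub>1 \<delta>"
      using elim by (simp_all add: d\<^sub>2_def d\<^sub>1_def)
    have sd: "\<delta> * s \<delta> = d\<^sub>2 \<delta> - d\<^sub>1 \<delta>"
      using elim by (simp add: s_def d\<^sub>2_def d\<^sub>1_def field_simps power2_eq_square)
    have n: "A * u (t + \<delta>) - (A - \<delta> * (\<beta> - \<delta>)) * u t = \<delta> * n\<^sub>2 \<delta>"
      "A * u t - (A - \<delta> * (\<beta> - \<delta>)) * u (t - \<delta>) = \<delta> * n\<^sub>1 \<delta>"
      unfolding n\<^sub>2_def n\<^sub>1_def ud by algebra+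
    have m: "h * u t - (h - \<delta>) * u (t + \<delta>) = \<delta> * m\<^sub>2 \<delta>"
      "h * u (t - \<delta>) - (h - \<delta>) * u t = \<delta> * m\<^sub>1 \<delta>"
      unfolding m\<^sub>2_def m\<^sub>1_def ud by algebra+
    have "n\<^sub>2 \<delta> - n\<^sub>1 \<delta> = \<delta> * (A * s \<delta> + (\<beta> - \<delta>) * d\<^sub>1 \<delta>)"
      unfolding n\<^sub>2_def n\<^sub>1_def ud using sd by algebra
    then have n': "A * s \<delta> + (\<beta> - \<delta>) * d\<^sub>1 \<delta> = (n\<^sub>2 \<delta> - n\<^sub>1 \<delta>) / \<delta>"
      using elim by simp
    have "m\<^sub>2 \<delta> - m\<^sub>1 \<delta> = \<delta> * (d\<^sub>2 \<delta> - h * s \<delta>)"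
      unfolding m\<^sub>2_def m\<^sub>1_def ud using sd by algebra
    then have m': "d\<^sub>2 \<delta> - h * s \<delta> = (m\<^sub>2 \<delta> - m\<^sub>1 \<delta>) / \<delta>"
      using elim by simp
    show ?case
      unfolding n m n' m' using elim
      by (simp only: central_difference_quotient_identity[OF elim(3,1,2)]
          mult_divide_mult_cancel_left[OF elim(3)])
  qed
  then show ?thesis
    by (rule Lim_transform_eventually[OF lim])
qed

text \<open>Splitting off the \<delta> in \<open>h - \<delta>\<close> leaves \<open>h\<close> times
  a central difference quotient, plus f(t - \<delta>/2) or minus f(t + \<delta>/2). The first limit
  serves for the reciprocal of \<open>v (-1)\<close>, the second for \<open>v 1\<close>.\<close>

lemma shifted_diff_quotient_tendsto:
  fixes f :: "real \<Rightarrow> real"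
  assumes "(f has_real_derivative D) (at t)"
  shows "((\<lambda>\<delta>. (h * f (t + \<delta> / 2) - (h - \<delta>) * f (t - \<delta> / 2)) / \<delta>) \<longlongrightarrow> h * D + f t) (at 0)"
    and "((\<lambda>\<delta>. ((h - \<delta>) * f (t + \<delta> / 2) - h * f (t - \<delta> / 2)) / \<delta>) \<longlongrightarrow> h * D - f t) (at 0)"
proof -
  have d: "((\<lambda>\<delta>. (f (t + \<delta> / 2) - f (t - \<delta> / 2)) / \<delta>) \<longlongrightarrow> D) (at 0)"
    using DERIV_imp_central_diff_quotient[OF assms, of "1/2"] by simp
  have p: "((\<lambda>\<delta>. f (t + \<delta> / 2)) \<longlongrightarrow> f t) (at 0)" and m: "((\<lambda>\<delta>. f (t - \<delta> / 2)) \<longlongrightarrow> f t) (at 0)"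
    using DERIV_imp_tendsto_scaled[OF assms, of "1/2"] DERIV_imp_tendsto_scaled[OF assms, of "-1/2"]
    by simp_all
  have ne: "\<forall>\<^sub>F \<delta>::real in at 0. \<delta> \<noteq> 0"
    by (auto simp: eventually_at_filter)
  show "((\<lambda>\<delta>. (h * f (t + \<delta> / 2) - (h - \<delta>) * f (t - \<delta> / 2)) / \<delta>) \<longlongrightarrow> h * D + f t) (at 0)"
    by (rule Lim_transform_eventually[OF tendsto_add[OF tendsto_mult_left[OF d] m]],
        rule eventually_mono[OF ne]) (simp add: field_simps)
  show "((\<lambda>\<delta>. ((h - \<delta>) * f (t + \<delta> / 2) - h * f (t - \<delta> / 2)) / \<delta>) \<longlongrightarrow> h * D - f t) (at 0)"
    by (rule Lim_transform_eventually[OF tendsto_diff[OF tendsto_mult_left[OF d] p]],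
        rule eventually_mono[OF ne]) (simp add: field_simps)
qed

section \<open>Sum of the three limits and comparison with the stated expression\<close>

theorem mainTheorem9:
  fixes \<alpha>0 \<alpha>1 \<alpha>2 p a \<tau> :: real and v :: "int \<Rightarrow> real \<Rightarrow> real"
  defines "g \<equiv> g3 \<alpha>0 \<alpha>1 \<alpha>2"
  defines "\<Pi>1 \<equiv> (g p - g a) / (a - p)"
  defines "\<Pi>2 \<equiv> - (a + 2 * p + \<alpha>2)"
  defines "E \<equiv> (\<lambda>\<delta>. A2_eq (g p - g a) (g (p - \<delta>) - g a) (skew_x p a v \<tau> \<delta>))"
  defines "F \<equiv> (\<lambda>t. (v 1 t / v (-1) t)
                  * ((\<Pi>1 * deriv (v 0) t + \<Pi>2 * v 0 t) / ((p - a) * deriv (v 0) t - v 0 t)))"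
  assumes "p \<noteq> a"
    and "\<And>k. k \<in> {-2..2} \<Longrightarrow> smooth (v k)"
    and "\<And>k t. k \<in> {-2..2} \<Longrightarrow> v k t \<noteq> 0"
    and "(p - a) * deriv (v 0) \<tau> - v 0 \<tau> \<noteq> 0"
  shows "F differentiable (at \<tau>) \<and>
    ((\<lambda>\<delta>. - E \<delta> / \<delta>) \<longlongrightarrow>
       deriv F \<tau>
       - (v (-2) \<tau> / v (-1) \<tau>) * ((p - a) * (deriv (v (-1)) \<tau> / v (-1) \<tau>) - 1)
       + (v 1 \<tau> / v 2 \<tau>) * ((p - a) * (deriv (v 1) \<tau> / v 1 \<tau>) - 1)) (at 0)"
proof -
  define h where "h = p - a"
  \<comment> \<open>\<open>A\<close> is the cofactor of \<open>p - a\<close> in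
    \<open>g p - g a\<close>, and \<open>\<beta>\<close> is the derivative of that cofactor in p.
    They are the negatives of \<open>\<Pi>1\<close> and \<open>\<Pi>2\<close>.\<close>
  define A where "A = p\<^sup>2 + p * a + a\<^sup>2 + \<alpha>2 * (p + a) + \<alpha>1"
  define \<beta> where "\<beta> = a + 2 * p + \<alpha>2"
  define w where "w = (\<lambda>t. v 1 t / v (-1) t)"
  define u'' where "u'' = deriv (deriv (v 0)) \<tau>"
  define w' where "w' = (deriv (v 1) \<tau> * v (-1) \<tau> - v 1 \<tau> * deriv (v (-1)) \<tau>)
    / (v (-1) \<tau> * v (-1) \<tau>)"
  have h: "h \<noteq> 0"
    using \<open>p \<noteq> a\<close> by (simp add: h_def)
  note D = smooth_DERIV(1)[OF assms(7)]
  have nz: "v (-2) t \<noteq> 0" "v (-1) t \<noteq> 0" "v 0 t \<noteq> 0" "v 1 t \<noteq> 0" "v 2 t \<noteq> 0" for t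
    using assms(8) by simp_all
  have M: "v 0 \<tau> - h * deriv (v 0) \<tau> \<noteq> 0"
    using assms(9) by (simp add: h_def)
  have u: "(v 0 has_real_derivative deriv (v 0) t) (at t)" for t
    by (rule D) simp
  have u': "(deriv (v 0) has_real_derivative u'') (at \<tau>)"
    unfolding u''_def by (rule smooth_DERIV(2)[OF assms(7)]) simp
  have v1: "(v 1 has_real_derivative deriv (v 1) \<tau>) (at \<tau>)"
    and vm1: "(v (-1) has_real_derivative deriv (v (-1)) \<tau>) (at \<tau>)"
    by (rule D, simp)+
  have w: "(w has_real_derivative w') (at \<tau>)"
    unfolding w_def w'_def by (rule DERIV_divide[OF v1 vm1 nz(2)])
  have r: "((\<lambda>t. inverse (v (-1) t)) has_real_derivative
      - (deriv (v (-1)) \<tau> / (v (-1) \<tau> * v (-1) \<tau>))) (at \<tau>)"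
    using DERIV_inverse_fun[OF vm1 nz(2)] by (simp add: field_simps)

  have gp: "g p - g a = h * A"
    unfolding g_def h_def A_def by (rule g3_diff_factor)
  \<comment> \<open>The cofactor is a monic quadratic in p, so its expansion at
    \<open>p - \<delta>\<close> ends exactly with the term \<delta>^2.\<close>
  have gq: "g (p - \<delta>) - g a = (p - \<delta> - a) * (A - \<delta> * (\<beta> - \<delta>))" for \<delta>
    unfolding g_def g3_diff_factor A_def \<beta>_def by algebra
  have "\<Pi>1 = - A"
    using h unfolding \<Pi>1_def gp by (simp add: h_def field_simps)
  \<comment> \<open>Changing both signs is valid for denominator 0 too, so the two forms of
    \<open>F\<close> agree as functions on the whole line.\<close>
  have neg: "(- A * x + - \<beta> * y) / (h * x - y) = (A * x + \<beta> * y) / (y - h * x)" for x y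
    using minus_divide_divide[of "A * x + \<beta> * y" "y - h * x"] by simp
  have F: "F = (\<lambda>t. w t * ((A * deriv (v 0) t + \<beta> * v 0 t) / (v 0 t - h * deriv (v 0) t)))"
    unfolding F_def \<Pi>2_def \<beta>_def[symmetric] w_def h_def[symmetric] \<open>\<Pi>1 = - A\<close> neg ..
  \<comment> \<open>Written exactly as the limit in \<open>skew_limit_quotient_part\<close>, so the
    derivative of \<open>F\<close> and the limit coincide literally.\<close>
  let ?F' = "((A * u'' + \<beta> * deriv (v 0) \<tau>) * w \<tau> * (v 0 \<tau> - h * deriv (v 0) \<tau>)
       + (A * deriv (v 0) \<tau> + \<beta> * v 0 \<tau>) * w' * (v 0 \<tau> - h * deriv (v 0) \<tau>)
       - (A * deriv (v 0) \<tau> + \<beta> * v 0 \<tau>) * w \<tau> * (deriv (v 0) \<tau> - h * u''))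
       / ((v 0 \<tau> - h * deriv (v 0) \<tau>) * (v 0 \<tau> - h * deriv (v 0) \<tau>))"
  have DF: "(F has_real_derivative ?F') (at \<tau>)"
  proof -
    have "((\<lambda>t. (A * deriv (v 0) t + \<beta> * v 0 t) / (v 0 t - h * deriv (v 0) t)) has_real_derivative
        ((A * u'' + \<beta> * deriv (v 0) \<tau>) * (v 0 \<tau> - h * deriv (v 0) \<tau>)
          - (A * deriv (v 0) \<tau> + \<beta> * v 0 \<tau>) * (deriv (v 0) \<tau> - h * u''))
        / ((v 0 \<tau> - h * deriv (v 0) \<tau>) * (v 0 \<tau> - h * deriv (v 0) \<tau>))) (at \<tau>)"
      by (intro DERIV_divide DERIV_add DERIV_diff DERIV_cmult u u' M)
    from DERIV_mult[OF w this] have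
      "(F has_real_derivative w' * ((A * deriv (v 0) \<tau> + \<beta> * v 0 \<tau>) / (v 0 \<tau> - h * deriv (v 0) \<tau>))
        + ((A * u'' + \<beta> * deriv (v 0) \<tau>) * (v 0 \<tau> - h * deriv (v 0) \<tau>)
          - (A * deriv (v 0) \<tau> + \<beta> * v 0 \<tau>) * (deriv (v 0) \<tau> - h * u''))
        / ((v 0 \<tau> - h * deriv (v 0) \<tau>) * (v 0 \<tau> - h * deriv (v 0) \<tau>)) * w \<tau>) (at \<tau>)"
      unfolding F .
    moreover have "b * (n / m) + (n' * m - n * m') / (m * m) * c
        = (n' * c * m + n * b * m - n * c * m') / (m * m)" if "m \<noteq> 0" for b c n n' m m' :: real
      using that by (simp add: field_simps)
    ultimately show ?thesis
      using M by simp
  qed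

  have lim: "((\<lambda>\<delta>.
      ((A * v 0 (\<tau> + \<delta>) - (A - \<delta> * (\<beta> - \<delta>)) * v 0 \<tau>) / (h * v 0 \<tau> - (h - \<delta>) * v 0 (\<tau> + \<delta>))
          * w (\<tau> + \<delta> / 2)
       - (A * v 0 \<tau> - (A - \<delta> * (\<beta> - \<delta>)) * v 0 (\<tau> - \<delta>)) / (h * v 0 (\<tau> - \<delta>) - (h - \<delta>) * v 0 \<tau>)
          * w (\<tau> - \<delta> / 2)) / \<delta>
      + v (-2) \<tau> * ((h * inverse (v (-1) (\<tau> + \<delta> / 2)) - (h - \<delta>) * inverse (v (-1) (\<tau> - \<delta> / 2))) / \<delta>)
      + ((h - \<delta>) * v 1 (\<tau> + \<delta> / 2) - h * v 1 (\<tau> - \<delta> / 2)) / \<delta> / v 2 \<tau>)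
    \<longlongrightarrow> ?F' + v (-2) \<tau> * (h * - (deriv (v (-1)) \<tau> / (v (-1) \<tau> * v (-1) \<tau>)) + inverse (v (-1) \<tau>))
      + (h * deriv (v 1) \<tau> - v 1 \<tau>) / v 2 \<tau>) (at 0)"
    by (intro tendsto_add tendsto_mult_left tendsto_divide[OF _ tendsto_const]
        skew_limit_quotient_part[OF u u' w M] shifted_diff_quotient_tendsto(1)[OF r]
        shifted_diff_quotient_tendsto(2)[OF v1] nz)
  \<comment> \<open>This says that q differs from a, the condition on \<open>k\<close> in
    \<open>A2_eq_skew_x\<close>.\<close>
  have "\<forall>\<^sub>F \<delta> in at 0. \<delta> \<noteq> h"
    using tendsto_imp_eventually_ne[OF tendsto_ident_at, of 0 h UNIV] h by simp
  then have "\<forall>\<^sub>F \<delta> in at 0.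
      ((A * v 0 (\<tau> + \<delta>) - (A - \<delta> * (\<beta> - \<delta>)) * v 0 \<tau>) / (h * v 0 \<tau> - (h - \<delta>) * v 0 (\<tau> + \<delta>))
          * w (\<tau> + \<delta> / 2)
       - (A * v 0 \<tau> - (A - \<delta> * (\<beta> - \<delta>)) * v 0 (\<tau> - \<delta>)) / (h * v 0 (\<tau> - \<delta>) - (h - \<delta>) * v 0 \<tau>)
          * w (\<tau> - \<delta> / 2)) / \<delta>
      + v (-2) \<tau> * ((h * inverse (v (-1) (\<tau> + \<delta> / 2)) - (h - \<delta>) * inverse (v (-1) (\<tau> - \<delta> / 2))) / \<delta>)
      + ((h - \<delta>) * v 1 (\<tau> + \<delta> / 2) - h * v 1 (\<tau> - \<delta> / 2)) / \<delta> / v 2 \<tau> = - E \<delta> / \<delta>"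
  proof eventually_elim
    case (elim \<delta>)
    have k: "p - \<delta> - a = h - \<delta>" "h - \<delta> \<noteq> 0"
      using elim by (simp_all add: h_def)
    \<comment> \<open>Here \<open>x\<close> and \<open>y\<close> stand for the fractional summands
      at \<tau> - \<delta>/2 and \<tau> + \<delta>/2; the minus sign in front of \<open>E\<close>
      turns x - y into a forward-oriented central difference.\<close>
    have id: "(y - x) / \<delta> + z * (b / \<delta>) + c / \<delta> / e = - (x - y - (z * b + c / e)) / \<delta>"
      for x y z b c e :: real
      by (simp add: diff_divide_distrib add_divide_distrib mult.commute)
    show ?case
      unfolding E_def gp gq h_def
      unfolding A2_eq_skew_x[OF h[unfolded h_def] k(2)[folded k(1)]]
      \<comment> \<open>Only quotients with numerator \<open>h\<close> or
        \<open>h - \<delta>\<close> become products with \<open>inverse\<close>, as in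
        \<open>lim\<close>; all others keep their form.\<close>
      unfolding k(1) h_def[symmetric] w_def divide_inverse[of h] divide_inverse[of "h - \<delta>"]
      by (rule id)
  qed
  then have "((\<lambda>\<delta>. - E \<delta> / \<delta>) \<longlongrightarrow>
      ?F' + v (-2) \<tau> * (h * - (deriv (v (-1)) \<tau> / (v (-1) \<tau> * v (-1) \<tau>)) + inverse (v (-1) \<tau>))
      + (h * deriv (v 1) \<tau> - v 1 \<tau>) / v 2 \<tau>) (at 0)"
    by (rule Lim_transform_eventually[OF lim])
  moreover have "v (-2) \<tau> * (h * - (deriv (v (-1)) \<tau> / (v (-1) \<tau> * v (-1) \<tau>)) + inverse (v (-1) \<tau>))
      = - (v (-2) \<tau> / v (-1) \<tau>) * (h * (deriv (v (-1)) \<tau> / v (-1) \<tau>) - 1)"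
    and "(h * deriv (v 1) \<tau> - v 1 \<tau>) / v 2 \<tau> = (v 1 \<tau> / v 2 \<tau>) * (h * (deriv (v 1) \<tau> / v 1 \<tau>) - 1)"
    using nz[of \<tau>] by (simp_all add: field_simps)
  moreover have "F differentiable (at \<tau>)"
    using DF by (auto simp: real_differentiable_def)
  ultimately show ?thesis
    unfolding DERIV_imp_deriv[OF DF] h_def by simp
qed

end
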